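(* Let $Y$ be a real random variable whose moment generating function $E[e^{tY}]$ exists for $|t|<\rho$ for some $\rho>0$. For every integer $n\ge 0$ and every real $x$, $$D_{n}^{Y}(x)= n!\sum_{m=0}^{n}\frac{E\big[(x-Y)^{m}\big]}{m!}=\sum_{l=0}^{n}\binom{n}{l}D_{l}^{Y}x^{n-l}.$$
   Context: The probabilistic derangement polynomials $D_n^Y(x)$ associated with $Y$ are defined by the generating function (for $t$ near $0$) $$\frac{e^{xt}}{1-t}E\big[e^{-tY}\big]=\sum_{n=0}^{\infty}D_{n}^{Y}(x)\frac{t^{n}}{n!},$$ and the probabilistic derangement numbers are $D_n^Y=D_n^Y(0)$. Convention: $x^0=1$. *)

theory Defs
  imports "HOL-Probability.Probability"
begin

definition prob_derangement_egf :: "'a measure \<Rightarrow> ('a \<Rightarrow> real) \<Rightarrow> real \<Rightarrow> real \<Rightarrow> real" where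
  "prob_derangement_egf M Y x t =
     exp (x * t) / (1 - t) * prob_space.expectation M (\<lambda>\<omega>. exp (- t * Y \<omega>))"

(* The coefficient sequence is defined by the generating function itself, for t near 0.  It is
   unique whenever it exists, see prob_derangement_poly_eqI; "0 ^ 0 = 1" in HOL, so the series
   at t = 0 has the value d 0. *)
definition prob_derangement_poly :: "'a measure \<Rightarrow> ('a \<Rightarrow> real) \<Rightarrow> nat \<Rightarrow> real \<Rightarrow> real" where
  "prob_derangement_poly M Y n x =
     (THE d :: nat \<Rightarrow> real.
        \<forall>\<^sub>F t in nhds 0. (\<lambda>k. d k * t ^ k / fact k) sums prob_derangement_egf M Y x t) n"

definition prob_derangement_number :: "'a measure \<Rightarrow> ('a \<Rightarrow> real) \<Rightarrow> nat \<Rightarrow> real" where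
  "prob_derangement_number M Y n = prob_derangement_poly M Y n 0"

lemma powser_sums_zero_near_0:
  fixes a :: "nat \<Rightarrow> real"
  assumes "\<forall>\<^sub>F t in nhds 0. (\<lambda>n. a n * t ^ n) sums 0"
  shows "a k = 0"
proof (induction k rule: less_induct)
  case (less k)
  obtain s where s: "s > 0" "\<And>t. \<bar>t\<bar> < s \<Longrightarrow> (\<lambda>n. a n * t ^ n) sums 0"
    using assms unfolding eventually_nhds_metric by (auto simp: dist_real_def)
  have "(\<lambda>n. a (n + k) * t ^ n) sums 0" if "t \<noteq> 0" "norm t < s" for t
  proof -
    have "(\<lambda>n. a (n + k) * t ^ (n + k)) sums (0 - (\<Sum>i<k. a i * t ^ i))"
      using s(2)[of t] that by (intro sums_split_initial_segment) auto
    also have "(\<Sum>i<k. a i * t ^ i) = 0"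
      using less by (intro sum.neutral) auto
    finally have "(\<lambda>n. a (n + k) * t ^ (n + k) / t ^ k) sums (0 / t ^ k)"
      by (intro sums_divide) simp
    thus ?thesis using that by (simp add: power_add)
  qed
  hence "((\<lambda>_ :: real. 0 :: real) \<longlongrightarrow> a (0 + k)) (at 0)"
    by (rule powser_limit_0_strong[OF s(1)])
  moreover have "((\<lambda>_ :: real. 0 :: real) \<longlongrightarrow> 0) (at (0 :: real))"
    by (rule tendsto_const)
  ultimately have "a (0 + k) = 0"
    by (rule LIM_unique)
  thus ?case
    by (simp only: add_0)
qed

lemma prob_derangement_poly_eqI:
  assumes "\<forall>\<^sub>F t in nhds 0. (\<lambda>k. d k * t ^ k / fact k) sums prob_derangement_egf M Y x t"
  shows "prob_derangement_poly M Y n x = d n"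
proof -
  have "d' = d"
    if "\<forall>\<^sub>F t in nhds 0. (\<lambda>k. d' k * t ^ k / fact k) sums prob_derangement_egf M Y x t" for d'
  proof
    fix k
    have "\<forall>\<^sub>F t in nhds 0. (\<lambda>k. (d' k - d k) / fact k * t ^ k) sums 0"
      using that assms
    proof eventually_elim
      case (elim t)
      from sums_diff[OF elim] show ?case
        by (simp add: diff_divide_distrib left_diff_distrib)
    qed
    from powser_sums_zero_near_0[OF this, of k] show "d' k = d k" by simp
  qed
  thus ?thesis
    unfolding prob_derangement_poly_def by (subst the_equality[where a = d]) (use assms in blast)+
qed

end

theory Submission
  imports Defs
begin

text \<open>
  Put \<open>Z = x - Y\<close>.  Since \<open>exp (x * t) * E[exp (- t * Y)] = E[exp (t * Z)]\<close>, the generating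
  function of the derangement polynomials at \<open>x\<close> is the product of \<open>1 / (1 - t)\<close>, the exponential
  generating function of \<open>fact\<close>, and of the moment generating function of \<open>Z\<close>, the exponential
  generating function of the moments of \<open>Z\<close>.  It is also the product of \<open>exp (x * t)\<close>, the
  exponential generating function of the powers of \<open>x\<close>, and of the generating function at \<open>0\<close>,
  which belongs to the derangement numbers.  A product of exponential generating functions
  belongs to the binomial convolution of the sequences (\<open>egf_binomial_convolution\<close>), and a sequence
  is determined by its generating function near \<open>0\<close> (\<open>prob_derangement_poly_eqI\<close>); so the two
  factorisations give the two formulas.

  That the moments of \<open>Z\<close> have the generating function \<open>E[exp (t * Z)]\<close> is an exchange of
  integral and exponential series (\<open>moments_sums_integral_exp\<close> for \<open>f = t * Z\<close>).  It is allowed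
  because the moment generating function exists on both sides of \<open>0\<close>.
\<close>

text \<open>
  Dominated convergence, with \<open>exp \<bar>f\<bar> \<le> exp f + exp (- f)\<close> as the dominating function: it
  bounds each \<open>\<bar>f ^ k / fact k\<bar>\<close> and all partial sums of these.
\<close>

lemma moments_sums_integral_exp:
  fixes f :: "'a \<Rightarrow> real"
  assumes [measurable]: "f \<in> borel_measurable M"
    and int: "integrable M (\<lambda>\<omega>. exp (f \<omega>))" "integrable M (\<lambda>\<omega>. exp (- f \<omega>))"
  shows "(\<lambda>k. (\<integral>\<omega>. f \<omega> ^ k / fact k \<partial>M)) sums (\<integral>\<omega>. exp (f \<omega>) \<partial>M)"
proof -
  let ?g = "\<lambda>\<omega>. exp (f \<omega>) + exp (- f \<omega>)"
  have int_g: "integrable M ?g"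
    using int by (rule Bochner_Integration.integrable_add)
  have exp_series: "(\<lambda>k. y ^ k / fact k) sums exp y" for y :: real
    using exp_converges[of y] by (simp add: divide_inverse mult.commute)
  have partial: "(\<Sum>k\<in>I. norm (f \<omega> ^ k / fact k)) \<le> ?g \<omega>" if "finite I" for I \<omega>
  proof -
    have "(\<Sum>k\<in>I. norm (f \<omega> ^ k / fact k)) = (\<Sum>k\<in>I. \<bar>f \<omega>\<bar> ^ k / fact k)"
      by (simp add: power_abs)
    also have "\<dots> \<le> exp \<bar>f \<omega>\<bar>"
      unfolding sums_unique[OF exp_series[of "\<bar>f \<omega>\<bar>"]]
      by (rule sum_le_suminf[OF sums_summable[OF exp_series] that]) simp
    also have "\<dots> \<le> ?g \<omega>"
      by (auto simp: abs_if)
    finally show ?thesis .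
  qed
  have int_k: "integrable M (\<lambda>\<omega>. f \<omega> ^ k / fact k)" for k
    by (rule Bochner_Integration.integrable_bound[OF int_g])
       (use partial[of "{k}"] in \<open>auto simp: power_abs\<close>)
  have "(\<lambda>k. \<integral>\<omega>. f \<omega> ^ k / fact k \<partial>M) sums (\<integral>\<omega>. (\<Sum>k. f \<omega> ^ k / fact k) \<partial>M)"
  proof (rule sums_integral[OF int_k])
    show "AE \<omega> in M. summable (\<lambda>k. norm (f \<omega> ^ k / fact k))"
      using partial by (intro AE_I2 summableI_nonneg_bounded) auto
    have "(\<Sum>k<n. \<integral>\<omega>. norm (f \<omega> ^ k / fact k) \<partial>M) \<le> (\<integral>\<omega>. ?g \<omega> \<partial>M)" for n
    proof -
      have "(\<Sum>k<n. \<integral>\<omega>. norm (f \<omega> ^ k / fact k) \<partial>M)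
          = (\<integral>\<omega>. (\<Sum>k<n. norm (f \<omega> ^ k / fact k)) \<partial>M)"
        by (intro Bochner_Integration.integral_sum[symmetric] integrable_norm int_k)
      also have "\<dots> \<le> (\<integral>\<omega>. ?g \<omega> \<partial>M)"
        using partial
        by (intro integral_mono Bochner_Integration.integrable_sum integrable_norm int_k int_g) auto
      finally show ?thesis .
    qed
    thus "summable (\<lambda>k. \<integral>\<omega>. norm (f \<omega> ^ k / fact k) \<partial>M)"
      by (intro summableI_nonneg_bounded) auto
  qed
  thus ?thesis
    using exp_series by (simp add: sums_iff)
qed

text \<open>
  Convergence on a whole neighbourhood of \<open>0\<close>, rather than at a single point, is what makes both
  series converge absolutely on a smaller neighbourhood, as the Cauchy product requires.
\<close>

lemma egf_binomial_convolution:
  fixes a b :: "nat \<Rightarrow> real"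
  assumes "\<forall>\<^sub>F t in nhds 0. (\<lambda>k. a k * t ^ k / fact k) sums A t"
    and "\<forall>\<^sub>F t in nhds 0. (\<lambda>k. b k * t ^ k / fact k) sums B t"
  shows "\<forall>\<^sub>F t in nhds 0.
    (\<lambda>k. (\<Sum>l\<le>k. real (k choose l) * a l * b (k - l)) * t ^ k / fact k) sums (A t * B t)"
proof -
  obtain r where "r > 0"
    and r: "\<And>t. \<bar>t\<bar> < r \<Longrightarrow> (\<lambda>k. a k * t ^ k / fact k) sums A t"
           "\<And>t. \<bar>t\<bar> < r \<Longrightarrow> (\<lambda>k. b k * t ^ k / fact k) sums B t"
    using eventually_conj[OF assms] unfolding eventually_nhds_metric
    by (auto simp: dist_real_def)
  have abs_conv: "summable (\<lambda>k. norm (c k * t ^ k / fact k))"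
    if "\<And>t. \<bar>t\<bar> < r \<Longrightarrow> (\<lambda>k. c k * t ^ k / fact k) sums C t" and "\<bar>t\<bar> < r / 2"
    for c :: "nat \<Rightarrow> real" and C t
    using powser_insidea[of "\<lambda>k. c k / fact k" "r / 2" t] that(1)[of "r / 2"] that(2) \<open>r > 0\<close>
    by (simp add: sums_iff)
  have "(\<lambda>k. (\<Sum>l\<le>k. real (k choose l) * a l * b (k - l)) * t ^ k / fact k) sums (A t * B t)"
    if "\<bar>t\<bar> < r / 2" for t
  proof -
    have "\<bar>t\<bar> < r" using that \<open>r > 0\<close> by simp
    have "(\<lambda>k. \<Sum>l\<le>k. (a l * t ^ l / fact l) * (b (k - l) * t ^ (k - l) / fact (k - l)))
        sums ((\<Sum>k. a k * t ^ k / fact k) * (\<Sum>k. b k * t ^ k / fact k))"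
      by (rule Cauchy_product_sums; rule abs_conv[OF _ that]; erule r)
    moreover have "(\<Sum>l\<le>k. (a l * t ^ l / fact l) * (b (k - l) * t ^ (k - l) / fact (k - l)))
        = (\<Sum>l\<le>k. real (k choose l) * a l * b (k - l)) * t ^ k / fact k" for k
      unfolding sum_distrib_right sum_divide_distrib
    proof (intro sum.cong refl)
      fix l assume "l \<in> {..k}"
      hence "l \<le> k" by simp
      hence "t ^ k = t ^ l * t ^ (k - l)"
        by (simp flip: power_add)
      moreover have "real (k choose l) / fact k = 1 / (fact l * fact (k - l))"
        using \<open>l \<le> k\<close> by (simp add: binomial_fact)
      ultimately show "(a l * t ^ l / fact l) * (b (k - l) * t ^ (k - l) / fact (k - l))
          = real (k choose l) * a l * b (k - l) * t ^ k / fact k"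
        by (simp add: divide_inverse mult_ac)
    qed
    ultimately show ?thesis
      using r[OF \<open>\<bar>t\<bar> < r\<close>] by (simp add: sums_iff)
  qed
  thus ?thesis
    using \<open>r > 0\<close> unfolding eventually_nhds_metric
    by (intro exI[of _ "r / 2"]) (auto simp: dist_real_def)
qed

lemma egf_fact:
  "\<forall>\<^sub>F t in nhds (0 :: real). (\<lambda>k. fact k * t ^ k / fact k) sums (1 / (1 - t))"
proof -
  have "(\<lambda>k. fact k * t ^ k / fact k) sums (1 / (1 - t))" if "dist t 0 < 1" for t :: real
    using geometric_sums[of t] that by simp
  thus ?thesis
    unfolding eventually_nhds_metric using zero_less_one by blast
qed

lemma egf_powers:
  fixes x :: real
  shows "\<forall>\<^sub>F t in nhds 0. (\<lambda>k. x ^ k * t ^ k / fact k) sums exp (x * t)"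
proof (rule always_eventually, rule allI)
  fix t :: real
  show "(\<lambda>k. x ^ k * t ^ k / fact k) sums exp (x * t)"
    using exp_converges[of "x * t"] by (simp add: divide_inverse mult.commute power_mult_distrib)
qed

lemma egf_shifted_moments:
  fixes Y :: "'a \<Rightarrow> real" and \<rho> x :: real
  assumes [measurable]: "Y \<in> borel_measurable M"
    and "\<rho> > 0"
    and mgf: "\<And>t. \<bar>t\<bar> < \<rho> \<Longrightarrow> integrable M (\<lambda>\<omega>. exp (t * Y \<omega>))"
  shows "\<forall>\<^sub>F t in nhds 0. (\<lambda>k. (\<integral>\<omega>. (x - Y \<omega>) ^ k \<partial>M) * t ^ k / fact k)
           sums (exp (x * t) * (\<integral>\<omega>. exp (- t * Y \<omega>) \<partial>M))"
proof -
  have "(\<lambda>k. (\<integral>\<omega>. (x - Y \<omega>) ^ k \<partial>M) * t ^ k / fact k)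
          sums (exp (x * t) * (\<integral>\<omega>. exp (- t * Y \<omega>) \<partial>M))" if "\<bar>t\<bar> < \<rho>" for t
  proof -
    have exp_split: "exp (s * (x - Y \<omega>)) = exp (x * s) * exp (- s * Y \<omega>)" for s \<omega>
      by (simp add: algebra_simps flip: exp_add)
    have int: "integrable M (\<lambda>\<omega>. exp (s * (x - Y \<omega>)))" if "\<bar>s\<bar> < \<rho>" for s
      unfolding exp_split using mgf[of "- s"] that by (intro integrable_mult_right) simp
    have "(\<lambda>k. \<integral>\<omega>. (t * (x - Y \<omega>)) ^ k / fact k \<partial>M) sums (\<integral>\<omega>. exp (t * (x - Y \<omega>)) \<partial>M)"
      using int[of t] int[of "- t"] that by (intro moments_sums_integral_exp) simp_all
    thus ?thesis
      unfolding exp_split by (simp add: power_mult_distrib mult.commute)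
  qed
  thus ?thesis
    using \<open>\<rho> > 0\<close> unfolding eventually_nhds_metric
    by (intro exI[of _ \<rho>]) (auto simp: dist_real_def)
qed

theorem theorem2p1:
  fixes M :: "'a measure" and Y :: "'a \<Rightarrow> real" and \<rho> x :: real and n :: nat
  assumes "prob_space M"
    and "Y \<in> borel_measurable M"
    and "\<rho> > 0"
    and "\<And>t :: real. \<bar>t\<bar> < \<rho> \<Longrightarrow> integrable M (\<lambda>\<omega>. exp (t * Y \<omega>))"
  shows "prob_derangement_poly M Y n x =
           fact n * (\<Sum>m=0..n. prob_space.expectation M (\<lambda>\<omega>. (x - Y \<omega>) ^ m) / fact m)
         \<and> prob_derangement_poly M Y n x =
           (\<Sum>l=0..n. real (n choose l) * prob_derangement_number M Y l * x ^ (n - l))"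
proof
  define d where
    "d y k = (\<Sum>l\<le>k. real (k choose l) * (\<integral>\<omega>. (y - Y \<omega>) ^ l \<partial>M) * fact (k - l))" for y k
  have d_egf: "\<forall>\<^sub>F t in nhds 0. (\<lambda>k. d y k * t ^ k / fact k) sums prob_derangement_egf M Y y t" for y
    using egf_binomial_convolution[OF egf_shifted_moments[OF assms(2-4), of y] egf_fact]
    by (simp add: d_def prob_derangement_egf_def)
  have poly_eq: "prob_derangement_poly M Y k y = d y k" for k y
    by (rule prob_derangement_poly_eqI[OF d_egf])
  have "d x n = fact n * (\<Sum>m=0..n. (\<integral>\<omega>. (x - Y \<omega>) ^ m \<partial>M) / fact m)"
    unfolding d_def sum_distrib_left atLeast0AtMost
    by (intro sum.cong refl) (simp add: binomial_fact field_simps)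
  thus "prob_derangement_poly M Y n x =
      fact n * (\<Sum>m=0..n. prob_space.expectation M (\<lambda>\<omega>. (x - Y \<omega>) ^ m) / fact m)"
    by (simp add: poly_eq)
  have "\<forall>\<^sub>F t in nhds 0. (\<lambda>k. (\<Sum>l\<le>k. real (k choose l) * d 0 l * x ^ (k - l)) * t ^ k / fact k)
      sums prob_derangement_egf M Y x t"
    using egf_binomial_convolution[OF d_egf[of 0] egf_powers[of x]]
    by (simp add: prob_derangement_egf_def mult.commute)
  from prob_derangement_poly_eqI[OF this, of n]
  show "prob_derangement_poly M Y n x =
      (\<Sum>l=0..n. real (n choose l) * prob_derangement_number M Y l * x ^ (n - l))"
    by (simp add: prob_derangement_number_def poly_eq atLeast0AtMost)
qed

end
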